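(* Every circle in $\mathbb{C}$, equipped with the Euclidean metric, admits approximate continuous transport.
   Context: For a compact metric space $(X,d)$, $\mathcal{M}(X)$ is the set of Borel probability measures on $X$, and $\mathcal{M}_g(X)\subseteq\mathcal{M}(X)$ is the set of fully supported diffuse (atomless) measures. The optimal matching distance is $$\delta(\mu,\nu)=\inf\{r \mid \mu(U)\le\nu(U_r)\text{ and }\nu(U)\le\mu(U_r)\text{ for all Borel }U\subseteq X\},\qquad U_r=\{x\in X\mid d(x,U)<r\}.$$ A nonempty compact path-connected metric space $(X,d)$ admits approximate continuous transport if for every $\mu,\nu\in\mathcal{M}_g(X)$ there is a sequence of homeomorphisms $h_n\colon X\to X$ such that $(h_n)_*\nu\to\mu$ in the weak-$^*$ topology and $\limsup_n\sup_{x\in X}d(h_n(x),x)\le\delta(\mu,\nu)$. Here $h_*\nu$ is the pushforward measure. *)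

theory Defs
  imports "HOL-Probability.Probability"
begin

text \<open>Compact metric spaces are rendered as subsets \<open>X\<close> of a metric space type, with the
  restricted metric; Borel measures on \<open>X\<close> live on the trace Borel algebra of \<open>X\<close>.\<close>

definition borel_probs :: "'a::metric_space set \<Rightarrow> 'a measure set" where
  "borel_probs X = {\<mu>. prob_space \<mu> \<and> sets \<mu> = sets (restrict_space borel X)}"

definition fully_supported_on :: "'a::metric_space set \<Rightarrow> 'a measure \<Rightarrow> bool" where
  "fully_supported_on X \<mu> \<longleftrightarrow>
     (\<forall>U. openin (top_of_set X) U \<and> U \<noteq> {} \<longrightarrow> measure \<mu> U > 0)"

definition diffuse_on :: "'a::metric_space set \<Rightarrow> 'a measure \<Rightarrow> bool" where
  "diffuse_on X \<mu> \<longleftrightarrow> (\<forall>x\<in>X. measure \<mu> {x} = 0)"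

definition good_probs :: "'a::metric_space set \<Rightarrow> 'a measure set" where
  "good_probs X = {\<mu> \<in> borel_probs X. fully_supported_on X \<mu> \<and> diffuse_on X \<mu>}"

text \<open>The guard \<open>U \<noteq> {}\<close> reflects \<open>d(x, \<emptyset>) = \<infinity>\<close>; the library has \<open>infdist x {} = 0\<close>.\<close>

definition thickening :: "'a::metric_space set \<Rightarrow> real \<Rightarrow> 'a set \<Rightarrow> 'a set" where
  "thickening X r U = {x \<in> X. U \<noteq> {} \<and> infdist x U < r}"

text \<open>For probability measures on a nonempty compact \<open>X\<close> the set below is nonempty (it contains
  every \<open>r > diameter X\<close>) and contains only positive numbers (take \<open>U = X\<close>), so the real infimum
  is the intended one.\<close>

definition matching_dist :: "'a::metric_space set \<Rightarrow> 'a measure \<Rightarrow> 'a measure \<Rightarrow> real" where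
  "matching_dist X \<mu> \<nu> =
     Inf {r. \<forall>U \<in> sets (restrict_space borel X).
               measure \<mu> U \<le> measure \<nu> (thickening X r U) \<and>
               measure \<nu> U \<le> measure \<mu> (thickening X r U)}"

definition weak_star_conv ::
    "'a::metric_space set \<Rightarrow> (nat \<Rightarrow> 'a measure) \<Rightarrow> 'a measure \<Rightarrow> bool" where
  "weak_star_conv X \<mu>s \<mu> \<longleftrightarrow>
     (\<forall>f :: 'a \<Rightarrow> real. continuous_on X f \<longrightarrow>
        (\<lambda>n. integral\<^sup>L (\<mu>s n) f) \<longlonglongrightarrow> integral\<^sup>L \<mu> f)"

definition admits_approx_continuous_transport :: "'a::metric_space set \<Rightarrow> bool" where
  "admits_approx_continuous_transport X \<longleftrightarrow>
     X \<noteq> {} \<and> compact X \<and> path_connected X \<and>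
     (\<forall>\<mu> \<in> good_probs X. \<forall>\<nu> \<in> good_probs X.
        \<exists>h :: nat \<Rightarrow> 'a \<Rightarrow> 'a.
          (\<forall>n. homeomorphic_map (top_of_set X) (top_of_set X) (h n)) \<and>
          weak_star_conv X (\<lambda>n. distr \<nu> (restrict_space borel X) (h n)) \<mu> \<and>
          limsup (\<lambda>n. ereal (SUP x\<in>X. dist (h n x) x)) \<le> ereal (matching_dist X \<mu> \<nu>))"

end

theory Submission
  imports Defs
begin

text \<open>
  Parametrise the circle by \<open>t \<mapsto> c + R exp(2\<pi>it)\<close> and lift the cumulative distribution functions
  of \<open>\<mu>\<close> and \<open>\<nu>\<close> to increasing homeomorphisms \<open>F, G\<close> of the line that commute with the unit
  translation. For every \<open>s\<close> the map \<open>F\<^sup>-\<^sup>1 \<circ> (G + s)\<close> descends to a homeomorphism of the circle that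
  pushes \<open>\<nu>\<close> forward to \<open>\<mu>\<close> exactly. It moves no point by more than \<open>\<rho> \<le> 1/2\<close> of a turn iff
  \<open>F (x - \<rho>) - G x \<le> s \<le> F (x + \<rho>) - G x\<close> for all \<open>x\<close>. Such an \<open>s\<close> exists because
  \<open>G y - G x \<le> F (y + \<rho>) - F (x - \<rho>)\<close> for all \<open>x, y\<close>, which after an integer shift is the
  matching condition for the arc from \<open>x\<close> to \<open>y\<close> (or trivial, when the thickened arc is everything).
\<close>

text \<open>A monotone function can only be discontinuous by jumping, and a jump would leave a gap
  in its range.\<close>

lemma continuous_mono_surj:
  fixes H :: "real \<Rightarrow> real"
  assumes "mono H" "surj H"
  shows "continuous_on UNIV H"
  using assms by (intro continuous_onI_mono) (auto dest: monoD)

section \<open>Parametrisation of the circle by full turns\<close>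

locale circle =
  fixes c :: complex and R :: real
  assumes R_pos: "R > 0"
begin

text \<open>Parameters count full turns, not radians, so that the period is 1 and integer parts
  count windings.\<close>

definition circ :: "real \<Rightarrow> complex" where
  "circ t = c + of_real R * cis (2 * pi * t)"

text \<open>Factoring out the rotation by \<open>t\<close> turns reduces to the distance of a unit
  complex number from 1, a chord given by the sine of half its angle.\<close>

lemma dist_circ: "dist (circ s) (circ t) = 2 * R * \<bar>sin (pi * (s - t))\<bar>"
proof -
  have "circ s - circ t = of_real R * cis (2 * pi * t) * (cis (2 * pi * (s - t)) - 1)"
    by (simp add: circ_def algebra_simps cis_mult)
  then have "dist (circ s) (circ t) = R * norm (cis (2 * pi * (s - t)) - 1)"
    using R_pos by (simp add: dist_norm norm_mult)
  also have "norm (cis (2 * pi * (s - t)) - 1) = 2 * \<bar>sin (pi * (s - t))\<bar>"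
    using dist_exp_i_1[of "2 * pi * (s - t)"] by (simp add: cis_conv_exp)
  finally show ?thesis by simp
qed

lemma circ_eq_iff: "circ s = circ t \<longleftrightarrow> (\<exists>n::int. s = t + of_int n)"
proof -
  have "circ s = circ t \<longleftrightarrow> sin (pi * (s - t)) = 0"
    using R_pos dist_circ[of s t]
    by (metis abs_eq_0_iff dist_eq_0_iff less_irrefl mult_eq_0_iff zero_neq_numeral)
  also have "\<dots> \<longleftrightarrow> (\<exists>n::int. s - t = of_int n)"
    by (simp add: sin_zero_iff_int2 mult.commute)
  finally show ?thesis by (simp add: algebra_simps)
qed

lemma circ_add_int [simp]: "circ (t + of_int n) = circ t"
  by (auto simp: circ_eq_iff)

lemma circ_image_shift: "circ ` {a + of_int n<..b + of_int n} = circ ` {a<..b}"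
proof -
  have "{a + of_int n<..b + of_int n} = (\<lambda>t. t + of_int n) ` {a<..b}"
    by (simp add: image_add_greaterThanAtMost[of "of_int n :: real", unfolded add.commute[of "of_int n"]])
  then show ?thesis by (simp add: image_image)
qed

lemma inj_on_circ: "inj_on circ {a<..a + 1}"
proof (rule inj_onI)
  fix s t assume st: "s \<in> {a<..a + 1}" "t \<in> {a<..a + 1}" "circ s = circ t"
  then obtain n :: int where n: "s = t + of_int n" by (auto simp: circ_eq_iff)
  with st have "\<bar>of_int n\<bar> < (1::real)" by auto
  then have "n = 0" by linarith
  with n show "s = t" by simp
qed

lemma circ_in_sphere [simp]: "circ t \<in> sphere c R"
  using R_pos by (simp add: circ_def dist_norm norm_mult)

lemma circ_surj:
  assumes "z \<in> sphere c R"
  obtains t where "t \<in> {a<..a + 1}" "circ t = z"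
proof -
  define s where "s = Arg (z - c) / (2 * pi)"
  have "cmod (z - c) = R" using assms by (simp add: dist_norm norm_minus_commute)
  then have "circ s = z"
    using rcis_cmod_Arg[of "z - c"] by (simp add: circ_def s_def rcis_def algebra_simps)
  \<comment> \<open>This integer shift puts the parameter into the half-open turn: subtracting
    \<open>ceiling - 1\<close> from \<open>s - a\<close> leaves a remainder in
    \<open>(0, 1]\<close>.\<close>
  then have "circ (s + of_int (1 - \<lceil>s - a\<rceil>)) = z"
    using circ_add_int by blast
  moreover have "s + of_int (1 - \<lceil>s - a\<rceil>) \<in> {a<..a + 1}"
    by (simp, linarith)
  ultimately show thesis by (rule that[rotated])
qed

lemma circ_image: "a + 1 \<le> b \<Longrightarrow> circ ` {a<..b} = sphere c R"
proof (intro equalityI subsetI)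
  fix z assume ab: "a + 1 \<le> b" and "z \<in> sphere c R"
  then obtain t where "t \<in> {a<..a + 1}" "circ t = z" using circ_surj by metis
  then show "z \<in> circ ` {a<..b}" using ab by force
qed (auto simp del: mem_sphere)

lemma continuous_on_circ [continuous_intros]: "continuous_on S circ"
  unfolding circ_def by (intro continuous_intros)

lemma compact_arc: "compact (circ ` {a..b})"
  by (intro compact_continuous_image continuous_on_circ) simp

lemma space_circle_borel: "space (restrict_space borel (sphere c R)) = sphere c R"
  by (simp add: space_restrict_space)

lemma sets_circle:
  "A \<in> sets (restrict_space borel (sphere c R)) \<longleftrightarrow> A \<subseteq> sphere c R \<and> A \<in> sets borel"
  by (rule sets_restrict_space_iff) simp

text \<open>Makes a half-open arc Borel, as a compact set minus a point. For
  \<open>b = a + 1\<close> this would fail, since the far end returns to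
  \<open>circ a\<close>.\<close>

lemma arc_eq: "a < b \<Longrightarrow> b < a + 1 \<Longrightarrow> circ ` {a<..b} = circ ` {a..b} - {circ a}"
proof -
  assume ab: "a < b" "b < a + 1"
  have "circ a \<notin> circ ` {a<..b}"
  proof
    assume "circ a \<in> circ ` {a<..b}"
    then obtain t where t: "a < t" "t \<le> b" "circ t = circ a" by force
    then obtain n :: int where "t = a + of_int n" by (auto simp: circ_eq_iff)
    with ab t show False by auto
  qed
  moreover have "{a..b} = insert a {a<..b}" using ab by auto
  ultimately show ?thesis by auto
qed

lemma arc_sets [measurable]: "circ ` {a<..b} \<in> sets (restrict_space borel (sphere c R))"
proof -
  consider "b \<le> a" | "a + 1 \<le> b" | "a < b" "b < a + 1" by linarith
  then have "circ ` {a<..b} \<in> sets borel"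
  proof cases
    case 3
    then show ?thesis using compact_arc[of a b] by (auto simp: arc_eq compact_imp_closed)
  qed (auto simp: circ_image)
  then show ?thesis by (auto simp: sets_circle simp del: mem_sphere)
qed

text \<open>Injectivity on the half-open turn identifies the complement with the compact arc from
  \<open>b\<close> to \<open>a + 1\<close>, which is closed.\<close>

lemma openin_arc:
  assumes "a < b" "b \<le> a + 1"
  shows "openin (top_of_set (sphere c R)) (circ ` {a<..<b})"
proof -
  have "circ ` {a<..<b} = circ ` {a<..a+1} - circ ` {b..a+1}"
  proof -
    have "{a<..<b} = {a<..a+1} - {b..a+1}" using assms by auto
    moreover have "circ ` ({a<..a+1} - {b..a+1}) = circ ` {a<..a+1} - circ ` {b..a+1}"
      using assms by (intro inj_on_image_set_diff[OF inj_on_circ]) auto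
    ultimately show ?thesis by simp
  qed
  also have "\<dots> = sphere c R - circ ` {b..a+1}" by (simp add: circ_image)
  finally show ?thesis
    using compact_arc[of b "a+1"]
    by (metis closed_subset compact_imp_closed openin_diff openin_subtopology_self
        circ_in_sphere image_subsetI)
qed

section \<open>Homeomorphisms and measures of the circle read off on the line\<close>

lemma descend_homeomorphic_map:
  fixes H :: "real \<Rightarrow> real"
  assumes H: "strict_mono H" "surj H" and H_add: "\<And>t n. H (t + of_int n) = H t + of_int n"
  obtains h where "homeomorphic_map (top_of_set (sphere c R)) (top_of_set (sphere c R)) h"
    "\<And>t. h (circ t) = circ (H t)"
proof -
  \<comment> \<open>Any parameter of \<open>z\<close> serves: two of them differ by an integer,
    which \<open>H\<close> carries through and \<open>circ\<close> forgets.\<close>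
  define h where "h z = circ (H (SOME t. circ t = z))" for z
  have h: "h (circ t) = circ (H t)" for t
  proof -
    have "circ (SOME s. circ s = circ t) = circ t" by (rule someI) (rule refl)
    then obtain n :: int where "(SOME s. circ s = circ t) = t + of_int n"
      by (auto simp: circ_eq_iff)
    then show ?thesis by (simp add: h_def H_add)
  qed
  let ?X = "top_of_set (sphere c R)"
  \<comment> \<open>A continuous surjection from a compact space to a Hausdorff space is a quotient
    map, so continuity of \<open>h\<close> can be tested on \<open>h \<circ> circ\<close>, that is
    on \<open>circ \<circ> H\<close>.\<close>
  have quot: "quotient_map (top_of_set {0..1}) ?X circ"
  proof (rule T1_Spaces.continuous_imp_quotient_map)
    show "continuous_map (top_of_set {0..1}) ?X circ"
      by (auto simp: continuous_map_in_subtopology continuous_on_circ simp del: mem_sphere)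
    have "circ ` {0<..1} \<subseteq> circ ` {0..1}" by auto
    moreover have "circ ` {0<..1} = sphere c R" by (rule circ_image) simp
    ultimately show "circ ` topspace (top_of_set {0..1}) = topspace ?X"
      by (auto simp del: mem_sphere)
  qed (auto simp: compact_space_subtopology Hausdorff_space_subtopology)
  have cH: "continuous_on UNIV H" using H by (intro continuous_mono_surj strict_mono_mono)
  have "continuous_map ?X ?X h"
  proof (rule continuous_compose_quotient_map[OF quot])
    have "continuous_on {0..1} (\<lambda>t. circ (H t))"
      by (rule continuous_on_compose2[OF continuous_on_circ[of UNIV]])
        (use cH continuous_on_subset in blast)+
    then show "continuous_map (top_of_set {0..1}) ?X (h \<circ> circ)"
      by (auto simp: continuous_map_in_subtopology o_def h simp del: mem_sphere)
  qed
  moreover have "h ` sphere c R = sphere c R"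
  proof (intro equalityI subsetI)
    fix z assume "z \<in> sphere c R"
    then obtain t where "circ t = z" using circ_surj by metis
    moreover obtain s where "t = H s" using H(2) by (metis surjD)
    ultimately show "z \<in> h ` sphere c R" using h[of s] by (metis circ_in_sphere imageI)
  qed (auto simp: h_def simp del: mem_sphere)
  moreover have "inj_on h (sphere c R)"
  proof (rule inj_onI)
    fix y z assume yz: "y \<in> sphere c R" "z \<in> sphere c R" "h y = h z"
    obtain s t where st: "y = circ s" "z = circ t" using yz circ_surj by metis
    with yz h obtain n :: int where "H s = H t + of_int n" by (auto simp: circ_eq_iff)
    then have "s = t + of_int n" using H(1) by (metis H_add strict_mono_eq)
    with st show "y = z" by simp
  qed
  ultimately have "homeomorphic_map ?X ?X h"
    by (intro continuous_imp_homeomorphic_map) (auto simp: compact_space_subtopology Hausdorff_space_subtopology)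
  with h that show thesis by blast
qed

text \<open>Cutting the circle open at \<open>circ 0\<close> turns these arcs into initial segments
  of \<open>{0<..1}\<close>, so the hypothesis says that two cumulative distribution functions
  agree. They determine the measures on the line, and \<open>circ\<close> undoes the cut.\<close>

lemma circle_measure_eqI:
  assumes M: "prob_space M" "sets M = sets (restrict_space borel (sphere c R))"
    and N: "prob_space N" "sets N = sets (restrict_space borel (sphere c R))"
    and eq: "\<And>b. 0 < b \<Longrightarrow> b \<le> 1 \<Longrightarrow> measure M (circ ` {0<..b}) = measure N (circ ` {0<..b})"
  shows "M = N"
proof -
  define l where "l = the_inv_into {0<..1} circ"
  have bij: "bij_betw circ {0<..1} (sphere c R)"
    using inj_on_circ[of 0] circ_image[of 0 1] by (simp add: bij_betw_def)
  have l: "l z \<in> {0<..1}" "circ (l z) = z" if "z \<in> sphere c R" for z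
    using bij that the_inv_into_into[of circ "{0<..1}" z "{0<..1}"] f_the_inv_into_f[of circ "{0<..1}" z]
    unfolding l_def bij_betw_def by blast+
  \<comment> \<open>The arc is empty for \<open>b \<le> 0\<close> and the whole circle for
    \<open>b \<ge> 1\<close>. Hence all sublevel sets of \<open>l\<close> are arcs, which yields
    both its measurability and its distribution function.\<close>
  have pre: "{z \<in> sphere c R. l z \<le> b} = circ ` {0<..min b 1}" for b
  proof (intro equalityI subsetI)
    fix z assume "z \<in> {z \<in> sphere c R. l z \<le> b}"
    then show "z \<in> circ ` {0<..min b 1}" using l[of z] by (intro image_eqI[of _ _ "l z"]) auto
  next
    fix z assume "z \<in> circ ` {0<..min b 1}"
    then obtain t where t: "z = circ t" "0 < t" "t \<le> b" "t \<le> 1" by auto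
    have "l z = t" unfolding l_def t(1) using inj_on_circ[of 0] t by (intro the_inv_into_f_f) auto
    with t show "z \<in> {z \<in> sphere c R. l z \<le> b}" by (auto simp del: mem_sphere)
  qed
  have l_meas: "l \<in> borel_measurable (restrict_space borel (sphere c R))"
    unfolding borel_measurable_iff_le space_circle_borel pre by (intro allI arc_sets)
  have circ_meas: "circ \<in> borel \<rightarrow>\<^sub>M restrict_space borel (sphere c R)"
    by (intro measurable_restrict_space2 borel_measurable_continuous_onI continuous_on_circ)
      (auto simp del: mem_sphere)
  have recover: "distr (distr K borel l) (restrict_space borel (sphere c R)) circ = K"
    if K: "sets K = sets (restrict_space borel (sphere c R))" for K
  proof -
    have lK: "l \<in> borel_measurable K" using l_meas measurable_cong_sets[OF K refl] by blast
    have "distr (distr K borel l) (restrict_space borel (sphere c R)) circ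
        = distr K (restrict_space borel (sphere c R)) (circ \<circ> l)"
      using lK circ_meas by (intro distr_distr)
    also have "\<dots> = distr K K (\<lambda>x. x)"
      using K l(2) sets_eq_imp_space_eq[OF K] by (intro distr_cong) (auto simp: space_circle_borel)
    finally show ?thesis by simp
  qed
  have cdf: "cdf (distr K borel l) b = (if b \<le> 0 then 0 else measure K (circ ` {0<..min b 1}))"
    if K: "sets K = sets (restrict_space borel (sphere c R))" for K b
  proof -
    have lK: "l \<in> borel_measurable K" using l_meas measurable_cong_sets[OF K refl] by blast
    have "l -` {..b} \<inter> space K = circ ` {0<..min b 1}"
      using pre[of b] sets_eq_imp_space_eq[OF K] by (auto simp: space_circle_borel simp del: mem_sphere)
    then show ?thesis using lK by (auto simp: cdf_def measure_distr)
  qed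
  have "l \<in> borel_measurable M" "l \<in> borel_measurable N"
    using l_meas measurable_cong_sets[OF M(2) refl] measurable_cong_sets[OF N(2) refl] by blast+
  then have "distr M borel l = distr N borel l"
    using M N eq by (intro cdf_unique ext) (auto simp: cdf prob_space.real_distribution_distr)
  then show ?thesis using recover M(2) N(2) by metis
qed

end

section \<open>Chordal against angular thickening\<close>

lemma (in circle) thickening_arc_subset:
  assumes "0 < \<rho>" "\<rho> \<le> 1/2"
  shows "thickening (sphere c R) (2 * R * sin (pi * \<rho>)) (circ ` {x<..y}) \<subseteq> circ ` {x - \<rho><..y + \<rho>}"
proof
  let ?U = "circ ` {x<..y}" and ?r = "2 * R * sin (pi * \<rho>)"
  fix z assume "z \<in> thickening (sphere c R) ?r ?U"
  then have z: "z \<in> sphere c R" "?U \<noteq> {}" "infdist z ?U < ?r" by (auto simp: thickening_def)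
  then have "(INF a\<in>?U. dist z a) < ?r" by (simp add: infdist_notempty)
  then obtain w where "w \<in> ?U" "dist z w < ?r"
    using z(2) cInf_lessD[of "dist z ` ?U"] by blast
  then obtain u where u: "u \<in> {x<..y}" "dist z (circ u) < ?r" by blast
  \<comment> \<open>With \<open>t\<close> chosen within half a turn of \<open>u\<close>, the angle
    \<open>pi * \<bar>t - u\<bar>\<close> stays in \<open>[0, pi/2]\<close>, where the sine is
    strictly increasing; a bound on the chord then becomes a bound on the angle.\<close>
  obtain t where t: "t \<in> {u - 1/2<..u - 1/2 + 1}" "circ t = z" using circ_surj[OF z(1)] .
  have "sin \<bar>pi * (t - u)\<bar> \<le> \<bar>sin (pi * (t - u))\<bar>"
    by (auto simp: abs_if)
  also have "\<dots> < sin (pi * \<rho>)" using u(2) t(2) R_pos dist_circ[of t u] by auto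
  finally have "sin (pi * \<bar>t - u\<bar>) < sin (pi * \<rho>)" by (simp add: abs_mult)
  moreover have "\<bar>t - u\<bar> \<le> 1/2" using t(1) unfolding greaterThanAtMost_iff by linarith
  then have "pi * \<bar>t - u\<bar> \<le> pi * (1/2)" "pi * \<rho> \<le> pi * (1/2)" "0 \<le> pi * \<bar>t - u\<bar>" "0 \<le> pi * \<rho>"
    using assms by (auto intro!: mult_left_mono simp del: times_divide_eq_right)
  ultimately have "pi * \<bar>t - u\<bar> < pi * \<rho>"
    using sin_mono_less_eq[of "pi * \<bar>t - u\<bar>" "pi * \<rho>"] pi_gt_zero by (simp, linarith)
  then have "\<bar>t - u\<bar> < \<rho>" by simp
  then have "t \<in> {x - \<rho><..y + \<rho>}" using u(1) by auto
  with t(2) show "z \<in> circ ` {x - \<rho><..y + \<rho>}" by blast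
qed

section \<open>The lifted distribution function of a diffuse, fully supported measure\<close>

locale circle_measure = circle +
  fixes \<mu> :: "complex measure"
  assumes good: "\<mu> \<in> good_probs (sphere c R)"
begin

lemma prob_space_\<mu>: "prob_space \<mu>"
  and sets_\<mu> [measurable_cong]: "sets \<mu> = sets (restrict_space borel (sphere c R))"
  using good by (auto simp: good_probs_def borel_probs_def)

sublocale prob_space \<mu> by (rule prob_space_\<mu>)

lemma space_\<mu>: "space \<mu> = sphere c R"
  using sets_eq_imp_space_eq[OF sets_\<mu>] by (simp add: space_circle_borel)

lemma arc_events [simp]: "circ ` {a<..b} \<in> events"
  by (simp add: sets_\<mu> arc_sets)

lemma prob_arc_add:
  assumes "a \<le> b" "b \<le> d" "d \<le> a + 1"
  shows "prob (circ ` {a<..d}) = prob (circ ` {a<..b}) + prob (circ ` {b<..d})"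
proof -
  have "{a<..d} = {a<..b} \<union> {b<..d}" using assms by auto
  moreover have "circ ` {a<..b} \<inter> circ ` {b<..d} = circ ` ({a<..b} \<inter> {b<..d})"
    using assms by (intro inj_on_image_Int[OF inj_on_circ, symmetric]) auto
  then have "circ ` {a<..b} \<inter> circ ` {b<..d} = {}" by auto
  ultimately show ?thesis
    using finite_measure_Union[OF arc_events[of a b] arc_events[of b d]] by (simp add: image_Un)
qed

lemma prob_arc_full: "a + 1 \<le> b \<Longrightarrow> prob (circ ` {a<..b}) = 1"
  using prob_space by (simp add: circ_image space_\<mu>)

lemma prob_arc_pos:
  assumes "a < b"
  shows "prob (circ ` {a<..b}) > 0"
proof -
  \<comment> \<open>Truncating to at most one turn makes the open arc results applicable; full
    support then gives the arc positive mass.\<close>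
  define b' where "b' = min b (a + 1)"
  have b': "a < b'" "b' \<le> a + 1" "b' \<le> b" using assms by (auto simp: b'_def)
  have "circ ((a + b') / 2) \<in> circ ` {a<..<b'}" using b' by auto
  then have "prob (circ ` {a<..<b'}) > 0"
    using good openin_arc[OF b'(1,2)] unfolding good_probs_def fully_supported_on_def by blast
  also have "prob (circ ` {a<..<b'}) \<le> prob (circ ` {a<..b})"
    using b' by (intro finite_measure_mono) auto
  finally show ?thesis .
qed

text \<open>A lift of the cumulative distribution function: the mass of \<open>(0, t]\<close> counted with windings.\<close>

definition lift :: "real \<Rightarrow> real" where
  "lift t = of_int \<lfloor>t\<rfloor> + prob (circ ` {of_int \<lfloor>t\<rfloor><..t})"

lemma lift_add_int: "lift (t + of_int n) = lift t + of_int n"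
  by (simp add: lift_def circ_image_shift)

text \<open>The points \<open>a\<close> and \<open>b\<close> lie in the same or in adjacent integer
  cells. In the second case the arc is split at the integer between them, and the total mass 1 of
  the first cell pays for the step of the floor.\<close>

lemma lift_diff:
  assumes "a \<le> b" "b \<le> a + 1"
  shows "lift b - lift a = prob (circ ` {a<..b})"
proof -
  define k where "k = \<lfloor>a\<rfloor>"
  have k: "of_int k \<le> a" "a < of_int k + 1" by (auto simp: k_def)
  consider "\<lfloor>b\<rfloor> = k" | "\<lfloor>b\<rfloor> = k + 1" using assms k by (fastforce simp: floor_eq_iff)
  then show ?thesis
  proof cases
    case 1
    then have "b < of_int k + 1" by linarith
    then have "prob (circ ` {of_int k<..b}) = prob (circ ` {of_int k<..a}) + prob (circ ` {a<..b})"
      using assms k by (intro prob_arc_add) auto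
    with 1 show ?thesis by (simp add: lift_def k_def)
  next
    case 2
    then have b: "of_int k + 1 \<le> b" by linarith
    have "prob (circ ` {of_int k<..of_int k + 1})
        = prob (circ ` {of_int k<..a}) + prob (circ ` {a<..of_int k + 1})"
      using k by (intro prob_arc_add) auto
    moreover have "prob (circ ` {a<..b})
        = prob (circ ` {a<..of_int k + 1}) + prob (circ ` {of_int k + 1<..b})"
      using k b assms by (intro prob_arc_add) auto
    ultimately show ?thesis using 2 prob_arc_full[of "of_int k" "of_int k + 1"]
      by (simp add: lift_def k_def[symmetric])
  qed
qed

lemma strict_mono_lift: "strict_mono lift"
proof (rule strict_monoI)
  fix a b :: real assume "a < b"
  \<comment> \<open>Peels off whole turns so that the remaining gap lies in \<open>(0, 1]\<close>,
    the range of \<open>lift_diff\<close>.\<close>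
  define n where "n = \<lceil>b - a\<rceil> - 1"
  have n: "0 \<le> n" "a + of_int n < b" "b \<le> a + of_int n + 1"
    using \<open>a < b\<close> unfolding n_def by linarith+
  have "lift a \<le> lift (a + of_int n)" using n by (simp add: lift_add_int)
  also have "\<dots> < lift b"
    using lift_diff[of "a + of_int n" b] prob_arc_pos[of "a + of_int n" b] n by simp
  finally show "lift a < lift b" .
qed

text \<open>By continuity from above the limit is the mass of the intersection, which contains at
  most the point \<open>circ a\<close>; diffuseness makes it null.\<close>

lemma prob_shrinking_arcs:
  "(\<lambda>n. prob (circ ` {a - 1 / real (n + 2)<..a + 1 / real (n + 2)})) \<longlonglongrightarrow> 0"
proof -
  let ?I = "\<lambda>n. {a - 1 / real (n + 2)<..a + 1 / real (n + 2)}"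
  let ?A = "\<lambda>n. circ ` ?I n"
  have I: "?I m \<subseteq> ?I n" if "n \<le> m" for m n
  proof -
    have "1 / real (m + 2) \<le> 1 / real (n + 2)" using that by (intro divide_left_mono) auto
    then show ?thesis by auto
  qed
  \<comment> \<open>Starting the radii at \<open>1/2\<close> keeps all intervals in one half-open
    turn, so a point common to the arcs has the same parameter in each of them.\<close>
  have I0: "?I n \<subseteq> {a - 1/2<..a - 1/2 + 1}" for n
    using I[of 0 n] by (simp add: add.commute)
  have "decseq ?A" by (intro decseq_SucI image_mono I) simp
  then have lim: "(\<lambda>n. prob (?A n)) \<longlonglongrightarrow> prob (\<Inter>n. ?A n)"
    by (intro finite_Lim_measure_decseq) auto
  have "(\<Inter>n. ?A n) \<subseteq> {circ a}"
  proof
    fix z assume z: "z \<in> (\<Inter>n. ?A n)"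
    then obtain t where t: "t \<in> ?I 0" "z = circ t" by blast
    have "t \<in> ?I n" for n
    proof -
      obtain s where s: "s \<in> ?I n" "z = circ s" using z by blast
      have "s = t"
        using inj_onD[OF inj_on_circ _ subsetD[OF I0 s(1)] subsetD[OF I0 t(1)]] s(2) t(2) by simp
      with s show ?thesis by simp
    qed
    then have *: "\<bar>t - a\<bar> \<le> 1 / real (n + 2)" for n
      unfolding greaterThanAtMost_iff abs_le_iff by (smt (verit))
    have "t = a"
    proof (rule ccontr)
      assume "t \<noteq> a"
      then obtain n where "inverse (real (Suc n)) < \<bar>t - a\<bar>" using reals_Archimedean[of "\<bar>t - a\<bar>"] by auto
      moreover have "1 / real (n + 2) \<le> inverse (real (Suc n))" by (auto simp: field_simps)
      ultimately show False using *[of n] by linarith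
    qed
    with t show "z \<in> {circ a}" by simp
  qed
  moreover have "prob {circ a} = 0"
    using good circ_in_sphere unfolding good_probs_def diffuse_on_def by blast
  moreover have "{circ a} \<in> events" by (simp add: sets_\<mu> sets_circle del: mem_sphere)
  ultimately have "prob (\<Inter>n. ?A n) = 0"
    using finite_measure_mono[of "\<Inter>n. ?A n" "{circ a}"] measure_nonneg[of \<mu> "\<Inter>n. ?A n"] by linarith
  with lim show ?thesis by simp
qed

text \<open>By monotonicity, changes of \<open>lift\<close> near \<open>a\<close> are bounded by the
  mass of one small arc around \<open>circ a\<close>.\<close>

lemma isCont_lift: "isCont lift a"
  unfolding continuous_at_eps_delta
proof (intro allI impI)
  fix e :: real assume "e > 0"
  then obtain n where "prob (circ ` {a - 1 / real (n + 2)<..a + 1 / real (n + 2)}) < e"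
    using eventually_happens[OF order_tendstoD(2)[OF prob_shrinking_arcs[of a]]] by auto
  moreover define d where "d = 1 / real (n + 2)"
  ultimately have less: "prob (circ ` {a - d<..a + d}) < e" by simp
  have d: "d > 0" "d \<le> 1/2" by (auto simp: d_def field_simps)
  have *: "lift (a + d) - lift (a - d) < e"
    using less lift_diff[of "a - d" "a + d"] d by simp
  have "dist (lift x) (lift a) < e" if "dist x a < d" for x
  proof -
    have "lift (a - d) \<le> lift x" "lift x \<le> lift (a + d)" "lift (a - d) \<le> lift a" "lift a \<le> lift (a + d)"
      using that d by (auto simp: strict_mono_less_eq[OF strict_mono_lift] dist_real_def)
    with * show ?thesis by (auto simp: dist_real_def)
  qed
  then show "\<exists>d>0. \<forall>x. dist x a < d \<longrightarrow> dist (lift x) (lift a) < e" using d by blast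
qed

lemma surj_lift: "surj lift"
proof (rule surjI[of _ "\<lambda>y. SOME t. lift t = y"], rule someI_ex)
  fix y
  \<comment> \<open>Integer translates of \<open>lift 0\<close> bracket \<open>y\<close>, so the
    intermediate value theorem applies.\<close>
  define m n where "m = \<lfloor>y - lift 0\<rfloor>" and "n = \<lceil>y - lift 0\<rceil>"
  have "lift (of_int m) \<le> y" "y \<le> lift (of_int n)"
    using lift_add_int[of 0 m] lift_add_int[of 0 n] unfolding m_def n_def by (simp, linarith)+
  moreover have "of_int m \<le> (of_int n :: real)" unfolding m_def n_def by linarith
  ultimately show "\<exists>t. lift t = y"
    using IVT[of lift "of_int m" y "of_int n"] isCont_lift by blast
qed

end


section \<open>Exact transport from the arc inequalities\<close>

lemma (in circle) exact_transport:
  assumes \<mu>: "\<mu> \<in> good_probs (sphere c R)" and \<nu>: "\<nu> \<in> good_probs (sphere c R)" and r: "r > 0"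
    and arcs: "\<And>x y. measure \<nu> (circ ` {x<..y}) \<le> measure \<mu> (thickening (sphere c R) r (circ ` {x<..y}))"
  obtains h where "homeomorphic_map (top_of_set (sphere c R)) (top_of_set (sphere c R)) h"
    "distr \<nu> (restrict_space borel (sphere c R)) h = \<mu>"
    "\<And>z. z \<in> sphere c R \<Longrightarrow> dist (h z) z \<le> r"
proof -
  interpret M: circle_measure c R \<mu> by unfold_locales (rule \<mu>)
  interpret N: circle_measure c R \<nu> by unfold_locales (rule \<nu>)
  let ?F = M.lift and ?G = N.lift
  \<comment> \<open>Here \<open>\<rho>\<close> is the angular displacement, in turns, whose chord is
    \<open>r\<close>. The cap at 1 handles \<open>r \<ge> 2 * R\<close>, where half a turn already
    reaches every point.\<close>
  define q where "q = min 1 (r / (2 * R))"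
  have q: "0 < q" "q \<le> 1" using r R_pos by (auto simp: q_def)
  define \<rho> where "\<rho> = arcsin q / pi"
  have "pi * \<rho> = arcsin q" by (simp add: \<rho>_def)
  then have sin_\<rho>: "sin (pi * \<rho>) = q" using q by simp
  have "0 < arcsin q" using arcsin_less_arcsin[of 0 q] q by simp
  moreover have "arcsin q \<le> pi / 2" using arcsin_bounded[of q] q by simp
  ultimately have \<rho>: "0 < \<rho>" "\<rho> \<le> 1/2" by (auto simp: \<rho>_def field_simps)
  have r_ge: "2 * R * sin (pi * \<rho>) \<le> r" using R_pos by (simp add: sin_\<rho> q_def min_def field_simps)
  have r_eq: "2 * R * sin (pi * \<rho>) = r" if "\<rho> < 1/2"
  proof -
    have "q \<noteq> 1" using that by (auto simp: \<rho>_def)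
    then have "q = r / (2 * R)" by (auto simp: q_def min_def split: if_splits)
    then show ?thesis using R_pos by (simp add: sin_\<rho>)
  qed

  \<comment> \<open>If the thickened arc is shorter than a turn, then \<open>\<rho> < 1/2\<close>,
    its chord is exactly \<open>r\<close>, and the hypothesis on arcs applies. Otherwise the right
    side is at least 1 and the left side at most 1.\<close>
  have arc_ineq: "?G y - ?G x \<le> ?F (y + \<rho>) - ?F (x - \<rho>)" if "x \<le> y" "y < x + 1" for x y
  proof (cases "y + \<rho> < x - \<rho> + 1")
    case True
    then have "\<rho> < 1/2" using that by linarith
    have "?G y - ?G x = measure \<nu> (circ ` {x<..y})" using that by (intro N.lift_diff) auto
    also have "\<dots> \<le> measure \<mu> (thickening (sphere c R) r (circ ` {x<..y}))" by (rule arcs)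
    also have "\<dots> \<le> measure \<mu> (circ ` {x - \<rho><..y + \<rho>})"
      using thickening_arc_subset[OF \<rho>, of x y] r_eq[OF \<open>\<rho> < 1/2\<close>]
      by (intro M.finite_measure_mono M.arc_events) simp
    also have "\<dots> = ?F (y + \<rho>) - ?F (x - \<rho>)"
      using True that \<rho> by (intro M.lift_diff[symmetric]) auto
    finally show ?thesis .
  next
    case False
    then have "?F (x - \<rho> + 1) \<le> ?F (y + \<rho>)" by (simp add: strict_mono_less_eq[OF M.strict_mono_lift])
    then have "1 \<le> ?F (y + \<rho>) - ?F (x - \<rho>)" using M.lift_add_int[of "x - \<rho>" 1] by simp
    moreover have "?G y - ?G x \<le> 1" using that N.lift_diff[of x y] by simp
    ultimately show ?thesis by linarith
  qed
  \<comment> \<open>Moving \<open>x\<close> by whole turns to just below \<open>y\<close> adds the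
    same integer to both lifts, which cancels.\<close>
  have cross: "?F (x - \<rho>) - ?G x \<le> ?F (y + \<rho>) - ?G y" for x y
  proof -
    define n where "n = \<lfloor>y - x\<rfloor>"
    have "x + of_int n \<le> y" "y < x + of_int n + 1" unfolding n_def by linarith+
    then have "?G y - ?G (x + of_int n) \<le> ?F (y + \<rho>) - ?F (x - \<rho> + of_int n)"
      using arc_ineq[of "x + of_int n" y] by (simp add: algebra_simps)
    then show ?thesis by (simp add: M.lift_add_int N.lift_add_int)
  qed
  \<comment> \<open>By \<open>cross\<close>, every lower constraint on \<open>s\<close> is below
    every upper one, so the supremum of the lower constraints exists and meets both.\<close>
  define s where "s = (SUP x. ?F (x - \<rho>) - ?G x)"
  have s_ge: "?F (x - \<rho>) - ?G x \<le> s" for x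
    unfolding s_def by (rule cSUP_upper) (auto intro: bdd_aboveI2 cross)
  have s_le: "s \<le> ?F (y + \<rho>) - ?G y" for y
    unfolding s_def by (rule cSUP_least) (auto intro: cross)

  define H where "H t = inv ?F (?G t + s)" for t
  have FH: "?F (H t) = ?G t + s" for t by (simp add: H_def surj_f_inv_f[OF M.surj_lift])
  have H_eqI: "H t = u" if "?F u = ?G t + s" for t u
    using that FH[of t] strict_mono_eq[OF M.strict_mono_lift] by metis
  have H_mono: "strict_mono H"
    by (rule strict_monoI)
      (metis FH M.strict_mono_lift N.strict_mono_lift add_less_cancel_right strict_mono_less)
  have H_surj: "surj H"
    unfolding surj_def
  proof
    fix u
    obtain t where "?F u - s = ?G t" using surjD[OF N.surj_lift] by blast
    then have "H t = u" by (intro H_eqI) simp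
    then show "\<exists>t. u = H t" by blast
  qed
  have H_add: "H (t + of_int n) = H t + of_int n" for t n
    by (rule H_eqI) (simp add: M.lift_add_int N.lift_add_int FH)
  have H_near: "\<bar>H t - t\<bar> \<le> \<rho>" for t
  proof -
    \<comment> \<open>The constraints on \<open>s\<close> at \<open>t\<close> say exactly this after
      applying \<open>?F\<close> to \<open>H t\<close>; strict monotonicity then removes
      \<open>?F\<close>.\<close>
    have "?F (t - \<rho>) \<le> ?F (H t)" "?F (H t) \<le> ?F (t + \<rho>)"
      using s_ge[of t] s_le[of t] FH[of t] by linarith+
    then show ?thesis by (simp add: strict_mono_less_eq[OF M.strict_mono_lift] abs_le_iff)
  qed
  obtain h where h: "homeomorphic_map (top_of_set (sphere c R)) (top_of_set (sphere c R)) h"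
    and h_circ: "\<And>t. h (circ t) = circ (H t)"
    using descend_homeomorphic_map[OF H_mono H_surj H_add] by blast

  have "dist (h z) z \<le> r" if z: "z \<in> sphere c R" for z
  proof -
    obtain t where t: "circ t = z" using circ_surj[OF z] by metis
    have le: "pi * \<bar>H t - t\<bar> \<le> pi * \<rho>" using H_near[of t] by simp
    have half: "pi * \<rho> \<le> pi / 2" using \<rho> by (simp add: field_simps)
    have nonneg: "0 \<le> pi * \<bar>H t - t\<bar>" by simp
    have "\<bar>sin (pi * (H t - t))\<bar> = \<bar>sin (pi * \<bar>H t - t\<bar>)\<bar>"
      by (simp add: abs_if minus_diff_eq[symmetric, of t] del: minus_diff_eq)
    also have "\<dots> = sin (pi * \<bar>H t - t\<bar>)"
      using le half nonneg pi_gt_zero by (intro abs_of_nonneg sin_ge_zero) linarith+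
    also have "\<dots> \<le> sin (pi * \<rho>)"
      using le half nonneg pi_gt_zero by (intro sin_monotone_2pi_le) linarith+
    finally have "2 * R * \<bar>sin (pi * (H t - t))\<bar> \<le> 2 * R * sin (pi * \<rho>)" using R_pos by simp
    then show ?thesis using r_ge dist_circ[of "H t" t] h_circ[of t] t by simp
  qed
  moreover have "distr \<nu> (restrict_space borel (sphere c R)) h = \<mu>"
  proof (rule circle_measure_eqI)
    have "continuous_map (top_of_set (sphere c R)) (top_of_set (sphere c R)) h"
      using h by (rule homeomorphic_imp_continuous_map)
    then have "continuous_on (sphere c R) h" "h ` sphere c R \<subseteq> sphere c R"
      by (auto simp: continuous_map_in_subtopology simp del: mem_sphere)
    then have "h \<in> restrict_space borel (sphere c R) \<rightarrow>\<^sub>M restrict_space borel (sphere c R)"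
      by (intro measurable_restrict_space2 borel_measurable_continuous_on_restrict)
        (auto simp: space_circle_borel simp del: mem_sphere)
    then have h_meas: "h \<in> \<nu> \<rightarrow>\<^sub>M restrict_space borel (sphere c R)"
      using measurable_cong_sets[OF N.sets_\<mu> refl] by blast
    then show "prob_space (distr \<nu> (restrict_space borel (sphere c R)) h)"
      by (rule N.prob_space_distr)
    show "measure (distr \<nu> (restrict_space borel (sphere c R)) h) (circ ` {0<..b})
        = measure \<mu> (circ ` {0<..b})" if b: "0 < b" "b \<le> 1" for b
    proof -
      \<comment> \<open>The preimage of the arc from 0 to \<open>b\<close> is the arc from
        \<open>u\<close> to \<open>v\<close>. Its mass \<open>?G v - ?G u\<close> equals
        \<open>?F b - ?F 0\<close>, as the constant \<open>s\<close> cancels.\<close>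
      obtain u v where uv: "0 = H u" "b = H v" using H_surj by (metis surjD)
      have less: "u < v" using uv b H_mono by (metis strict_mono_less)
      have "H v \<le> H (u + of_int 1)" unfolding H_add using uv b by simp
      then have le: "v \<le> u + 1" using H_mono by (simp add: strict_mono_less_eq)
      have "h -` (circ ` {0<..b}) \<inter> sphere c R = circ ` {u<..v}"
      proof (intro equalityI subsetI)
        fix z assume z: "z \<in> h -` (circ ` {0<..b}) \<inter> sphere c R"
        then obtain w where w: "h z = circ w" "0 < w" "w \<le> b" by auto
        obtain t where t: "circ t = z" using circ_surj z by (metis IntD2)
        then have "circ w = circ (H t)" using w h_circ by metis
        \<comment> \<open>The winding number is absorbed by replacing \<open>t\<close> with another
          parameter of the same point.\<close>
        then obtain n :: int where "w = H (t + of_int n)" by (auto simp: circ_eq_iff H_add)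
        with w uv have "H u < H (t + of_int n)" "H (t + of_int n) \<le> H v" by simp_all
        then have "t + of_int n \<in> {u<..v}"
          using H_mono by (auto simp: strict_mono_less strict_mono_less_eq)
        with t show "z \<in> circ ` {u<..v}" by (metis circ_add_int imageI)
      next
        fix z assume "z \<in> circ ` {u<..v}"
        then obtain t where "z = circ t" "H u < H t" "H t \<le> H v"
          using H_mono by (auto simp: strict_mono_less strict_mono_less_eq)
        then show "z \<in> h -` (circ ` {0<..b}) \<inter> sphere c R"
          using uv by (auto simp: h_circ simp del: mem_sphere)
      qed
      then have "measure (distr \<nu> (restrict_space borel (sphere c R)) h) (circ ` {0<..b})
          = measure \<nu> (circ ` {u<..v})"
        using h_meas by (simp add: measure_distr arc_sets N.space_\<mu>)
      also have "\<dots> = ?G v - ?G u" using less le by (intro N.lift_diff[symmetric]) auto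
      also have "\<dots> = ?F b - ?F 0" using FH[of u] FH[of v] uv by simp
      also have "\<dots> = measure \<mu> (circ ` {0<..b})" using b by (intro M.lift_diff) auto
      finally show ?thesis .
    qed
  qed (auto simp: M.prob_space_\<mu> M.sets_\<mu>)
  ultimately show thesis using that h by blast
qed

section \<open>Passage to the infimum of the admissible radii\<close>

theorem proposition2p5:
  fixes c :: complex and r :: real
  assumes "r > 0"
  shows "admits_approx_continuous_transport (sphere c r)"
proof -
  interpret circle c r by unfold_locales (rule assms)
  let ?X = "sphere c r"
  have "\<exists>h. (\<forall>n. homeomorphic_map (top_of_set ?X) (top_of_set ?X) (h n)) \<and>
          weak_star_conv ?X (\<lambda>n. distr \<nu> (restrict_space borel ?X) (h n)) \<mu> \<and>
          limsup (\<lambda>n. ereal (SUP x\<in>?X. dist (h n x) x)) \<le> ereal (matching_dist ?X \<mu> \<nu>)"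
    if \<mu>: "\<mu> \<in> good_probs ?X" and \<nu>: "\<nu> \<in> good_probs ?X" for \<mu> \<nu>
  proof -
    interpret M: circle_measure c r \<mu> by unfold_locales (rule \<mu>)
    interpret N: circle_measure c r \<nu> by unfold_locales (rule \<nu>)
    define A where "A = {s. \<forall>U \<in> sets (restrict_space borel ?X).
               measure \<mu> U \<le> measure \<nu> (thickening ?X s U) \<and>
               measure \<nu> U \<le> measure \<mu> (thickening ?X s U)}"
    have matching_dist: "matching_dist ?X \<mu> \<nu> = Inf A" by (simp add: matching_dist_def A_def)
    \<comment> \<open>The test set is the whole circle: it has mass 1, while its thickening by a
      nonpositive radius is empty.\<close>
    have A_pos: "s > 0" if "s \<in> A" for s
    proof (rule ccontr)
      assume "\<not> s > 0"
      then have "thickening ?X s ?X = {}" using infdist_nonneg[of _ ?X] by (force simp: thickening_def)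
      moreover have "measure \<mu> ?X \<le> measure \<nu> (thickening ?X s ?X)"
        using that by (auto simp: A_def sets_circle)
      ultimately show False using M.prob_space by (simp add: M.space_\<mu>)
    qed
    \<comment> \<open>A radius above the diameter thickens every nonempty set to the whole circle.
      This makes \<open>A\<close> nonempty, so that elements of \<open>A\<close> come arbitrarily
      close to \<open>Inf A\<close>.\<close>
    have "2 * r + 1 \<in> A"
    proof -
      have "thickening ?X (2 * r + 1) U = ?X" if "U \<subseteq> ?X" "U \<noteq> {}" for U
      proof -
        obtain u where u: "u \<in> U" using \<open>U \<noteq> {}\<close> by blast
        have "infdist x U < 2 * r + 1" if "x \<in> ?X" for x
        proof -
          have "infdist x U \<le> dist x u" using u by (rule infdist_le)
          also have "\<dots> \<le> dist c x + dist c u" by (metis dist_commute dist_triangle)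
          also have "\<dots> = 2 * r" using that u \<open>U \<subseteq> ?X\<close> by auto
          finally show ?thesis by simp
        qed
        with \<open>U \<noteq> {}\<close> show ?thesis by (auto simp: thickening_def)
      qed
      then have "measure \<mu> U \<le> measure \<nu> (thickening ?X (2 * r + 1) U) \<and>
          measure \<nu> U \<le> measure \<mu> (thickening ?X (2 * r + 1) U)"
        if "U \<in> sets (restrict_space borel ?X)" for U
        using that M.prob_space N.prob_space
        by (cases "U = {}") (auto simp: sets_circle M.space_\<mu> N.space_\<mu>)
      then show ?thesis by (simp add: A_def)
    qed
    then have "A \<noteq> {}" by blast
    have "\<exists>h. homeomorphic_map (top_of_set ?X) (top_of_set ?X) h \<and>
        distr \<nu> (restrict_space borel ?X) h = \<mu> \<and>
        (SUP x\<in>?X. dist (h x) x) \<le> Inf A + inverse (real (Suc n))" for n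
    proof -
      obtain s where s: "s \<in> A" "s < Inf A + inverse (real (Suc n))"
        using cInf_lessD[OF \<open>A \<noteq> {}\<close>, of "Inf A + inverse (real (Suc n))"] by auto
      have "measure \<nu> (circ ` {x<..y}) \<le> measure \<mu> (thickening ?X s (circ ` {x<..y}))" for x y
        using s(1) arc_sets unfolding A_def by blast
      then obtain h where h: "homeomorphic_map (top_of_set ?X) (top_of_set ?X) h"
        "distr \<nu> (restrict_space borel ?X) h = \<mu>" "\<And>z. z \<in> ?X \<Longrightarrow> dist (h z) z \<le> s"
        using exact_transport[OF \<mu> \<nu> A_pos[OF s(1)]] by metis
      have "?X \<noteq> {}" using circ_in_sphere by blast
      then have "(SUP x\<in>?X. dist (h x) x) \<le> s" using h(3) by (intro cSUP_least)
      with h s show ?thesis by fastforce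
    qed
    then obtain h where h: "\<And>n. homeomorphic_map (top_of_set ?X) (top_of_set ?X) (h n)"
      "\<And>n. distr \<nu> (restrict_space borel ?X) (h n) = \<mu>"
      "\<And>n. (SUP x\<in>?X. dist (h n x) x) \<le> Inf A + inverse (real (Suc n))"
      by metis
    have "limsup (\<lambda>n. ereal (SUP x\<in>?X. dist (h n x) x))
        \<le> limsup (\<lambda>n. ereal (Inf A + inverse (real (Suc n))))"
      using h(3) by (intro Limsup_mono) simp
    also have "\<dots> = ereal (Inf A)"
      using tendsto_add[OF tendsto_const LIMSEQ_inverse_real_of_nat, of "Inf A"]
      by (intro lim_imp_Limsup) auto
    \<comment> \<open>Every pushforward equals \<open>\<mu>\<close>, so the integrals form a
      constant sequence and weak-star convergence is immediate.\<close>
    finally show ?thesis using h(1,2) matching_dist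
      by (intro exI[of _ h]) (simp add: weak_star_conv_def)
  qed
  moreover have "path_connected ?X" using path_connected_sphere_eq[of c r] by simp
  moreover have "?X \<noteq> {}" using circ_in_sphere by blast
  ultimately show ?thesis by (auto simp: admits_approx_continuous_transport_def)
qed

end
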